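(* Let $R$ be a commutative ring, let $\mathfrak{a}\subseteq R$ be an ideal, and let $M$ be an $R$-module. If $R$ or $M$ is noetherian, then $M$ is $\mathfrak{a}$-fair and weakly $\mathfrak{a}$-fair.
   Context: Rings are commutative with unit. $\mathrm{Var}(\mathfrak{a})$ is the set of prime ideals of $R$ containing $\mathfrak{a}$, and $\Gamma_{\mathfrak{a}}(M)=\{x\in M\mid\exists n\in\mathbb{N}:\mathfrak{a}^nx=0\}$. For $x\in M$, $(0:_Rx)=\{r\in R\mid rx=0\}$. The assassin $\mathrm{Ass}_R(M)$ is the set of prime ideals of $R$ of the form $(0:_Rx)$ for some $x\in M$. The weak assassin $\mathrm{Ass}^{\rm f}_R(M)$ is the set of prime ideals $\mathfrak{p}$ of $R$ such that there exists $x\in M$ for which $\mathfrak{p}$ is minimal (with respect to inclusion) among the prime ideals containing $(0:_Rx)$. The $R$-module $M$ is called $\mathfrak{a}$-fair if $\mathrm{Ass}_R(M/\Gamma_{\mathfrak{a}}(M))=\mathrm{Ass}_R(M)\setminus\mathrm{Var}(\mathfrak{a})$, and weakly $\mathfrak{a}$-fair if $\mathrm{Ass}^{\rm f}_R(M/\Gamma_{\mathfrak{a}}(M))=\mathrm{Ass}^{\rm f}_R(M)\setminus\mathrm{Var}(\mathfrak{a})$. *)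

theory Defs
  imports "HOL-Algebra.Algebra"
begin

subsection \<open>Noetherian modules\<close>

definition gen_submodule ::
    "('a, 'r) ring_scheme \<Rightarrow> ('a, 'b, 'm) module_scheme \<Rightarrow> 'b set \<Rightarrow> 'b set"
  where "gen_submodule R M S = \<Inter>{N. submodule N R M \<and> S \<subseteq> N}"

text \<open>The module analogue of \<^locale>\<open>noetherian_ring\<close>.\<close>

locale noetherian_module = module R M
  for R :: "('a, 'r) ring_scheme" and M :: "('a, 'b, 'm) module_scheme" +
  assumes finitely_gen:
    "submodule N R M \<Longrightarrow> \<exists>S \<subseteq> carrier M. finite S \<and> N = gen_submodule R M S"


subsection \<open>Quotient modules\<close>

text \<open>The record type \<^typ>\<open>('a, 'b) module\<close> extends \<^typ>\<open>'b ring\<close>, so the fields \<^const>\<open>monoid.mult\<close> and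
  \<^const>\<open>one\<close> have to be filled in; they play no role for modules. Their values here
  are those of \<^const>\<open>FactRing\<close>.\<close>

definition FactModule :: "('a, 'b, 'm) module_scheme \<Rightarrow> 'b set \<Rightarrow> ('a, 'b set) module"
  where "FactModule M N =
    \<lparr>carrier = a_rcosets\<^bsub>M\<^esub> N, monoid.mult = rcoset_mult M N,
      one = N +>\<^bsub>M\<^esub> \<one>\<^bsub>M\<^esub>, ring.zero = N, add = set_add M,
      smult = (\<lambda>r C. \<Union>x\<in>C. N +>\<^bsub>M\<^esub> (r \<odot>\<^bsub>M\<^esub> x))\<rparr>"


subsection \<open>Torsion, annihilators and assassins\<close>

text \<open>The power of an ideal is the one in the monoid \<^term>\<open>ideals_set R\<close> of ideals under the
  ideal product; the zeroth power is \<^term>\<open>carrier R\<close>.\<close>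

definition torsion_part ::
    "('a, 'r) ring_scheme \<Rightarrow> 'a set \<Rightarrow> ('a, 'b, 'm) module_scheme \<Rightarrow> 'b set"
  where "torsion_part R I M =
    {x \<in> carrier M. \<exists>n::nat. \<forall>r \<in> I [^]\<^bsub>ideals_set R\<^esub> n. r \<odot>\<^bsub>M\<^esub> x = \<zero>\<^bsub>M\<^esub>}"

definition Var :: "('a, 'r) ring_scheme \<Rightarrow> 'a set \<Rightarrow> 'a set set"
  where "Var R I = {P. primeideal P R \<and> I \<subseteq> P}"

definition ann :: "('a, 'r) ring_scheme \<Rightarrow> ('a, 'b, 'm) module_scheme \<Rightarrow> 'b \<Rightarrow> 'a set"
  where "ann R M x = {r \<in> carrier R. r \<odot>\<^bsub>M\<^esub> x = \<zero>\<^bsub>M\<^esub>}"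

definition Ass :: "('a, 'r) ring_scheme \<Rightarrow> ('a, 'b, 'm) module_scheme \<Rightarrow> 'a set set"
  where "Ass R M = {P. primeideal P R \<and> (\<exists>x \<in> carrier M. P = ann R M x)}"

definition weak_Ass :: "('a, 'r) ring_scheme \<Rightarrow> ('a, 'b, 'm) module_scheme \<Rightarrow> 'a set set"
  where "weak_Ass R M =
    {P. \<exists>x \<in> carrier M. P \<in> Var R (ann R M x) \<and> (\<forall>Q \<in> Var R (ann R M x). Q \<subseteq> P \<longrightarrow> Q = P)}"


subsection \<open>Fairness\<close>

definition fair :: "('a, 'r) ring_scheme \<Rightarrow> 'a set \<Rightarrow> ('a, 'b, 'm) module_scheme \<Rightarrow> bool"
  where "fair R I M \<longleftrightarrow> Ass R (FactModule M (torsion_part R I M)) = Ass R M - Var R I"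

definition weakly_fair :: "('a, 'r) ring_scheme \<Rightarrow> 'a set \<Rightarrow> ('a, 'b, 'm) module_scheme \<Rightarrow> bool"
  where "weakly_fair R I M \<longleftrightarrow>
    weak_Ass R (FactModule M (torsion_part R I M)) = weak_Ass R M - Var R I"

end

theory Submission
  imports Defs
begin

text \<open>Write \<open>\<Gamma>\<close> for the \<open>I\<close>-torsion submodule of \<open>M\<close>, where \<open>I\<close> is the given ideal. Both
  noetherian hypotheses enter only through the ascending chain condition for ideals
  containing the annihilator \<open>(0 : x)\<close> of an element, which is the locale
  \<open>cyclically_noetherian_module\<close>. It passes from \<open>M\<close> to \<open>M/\<Gamma>\<close>, because annihilators only grow
  in a quotient.

  A prime \<open>P = (0 : x)\<close> that does not contain \<open>I\<close> stays the annihilator of \<open>x + \<Gamma>\<close>: if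
  \<open>I\<^sup>n r x = 0\<close>, then \<open>I\<^sup>n r \<subseteq> P\<close>, hence \<open>r \<in> P\<close> (\<open>Ass_minus_Var_subset\<close>).
  Conversely, let the prime \<open>P\<close> be the annihilator of \<open>x + \<Gamma>\<close>. It is the union of the ascending
  ideals \<open>(0 : I\<^sup>n x)\<close>, so by the chain condition \<open>I\<^sup>n P x = 0\<close> for a single \<open>n\<close>
  (\<open>torsion_uniform_exponent\<close>). Now \<open>I \<subseteq> P\<close> is impossible, as it would give \<open>I\<^sup>n\<^sup>+\<^sup>1 x = 0\<close> and
  \<open>x \<in> \<Gamma>\<close>; and for \<open>s \<in> I\<^sup>n - P\<close> the element \<open>s x\<close> of \<open>M\<close> has annihilator \<open>P\<close>
  (\<open>Ass_FactModule_torsion_subset\<close>). So \<open>M\<close> is fair.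

  Under the chain condition every prime containing \<open>(0 : x)\<close> contains an associated prime
  containing \<open>(0 : x)\<close> (\<open>exists_Ass_between\<close>). A minimal one is therefore itself associated, and
  assassins and weak assassins coincide (\<open>weak_Ass_eq_Ass\<close>). Applied to \<open>M\<close> and to \<open>M/\<Gamma>\<close>, this
  turns fairness into weak fairness.\<close>

section \<open>Annihilators and cyclic submodules\<close>

context module
begin

lemma mem_ann_iff: "r \<in> ann R M x \<longleftrightarrow> r \<in> carrier R \<and> r \<odot>\<^bsub>M\<^esub> x = \<zero>\<^bsub>M\<^esub>"
  by (simp add: ann_def)

lemma smult_left_commute:
  assumes "r \<in> carrier R" "s \<in> carrier R" "x \<in> carrier M"
  shows "r \<odot>\<^bsub>M\<^esub> (s \<odot>\<^bsub>M\<^esub> x) = s \<odot>\<^bsub>M\<^esub> (r \<odot>\<^bsub>M\<^esub> x)"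
  using assms by (metis R.m_comm smult_assoc1)

text \<open>Annihilators of elements are the case \<open>B = {\<one>}\<close>; powers of an ideal are the other
  case of interest.\<close>

lemma ideal_annihilating_multiple:
  assumes x: "x \<in> carrier M" and B: "B \<subseteq> carrier R"
  shows "ideal {r \<in> carrier R. \<forall>s\<in>B. s \<odot>\<^bsub>M\<^esub> (r \<odot>\<^bsub>M\<^esub> x) = \<zero>\<^bsub>M\<^esub>} R" (is "ideal ?J R")
proof (rule idealI)
  show "ring R" by (rule R.ring_axioms)
  show "subgroup ?J (add_monoid R)"
  proof (rule R.add.subgroupI)
    show "?J \<subseteq> carrier R" by blast
    show "?J \<noteq> {}" using x B by (auto intro!: exI[of _ \<zero>])
  next
    fix a assume "a \<in> ?J"
    thus "\<ominus> a \<in> ?J" using x B by (auto simp: smult_l_minus smult_r_minus)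
  next
    fix a b assume "a \<in> ?J" "b \<in> ?J"
    thus "a \<oplus> b \<in> ?J" using x B by (auto simp: smult_l_distr smult_r_distr subset_iff)
  qed
next
  fix a r assume a: "a \<in> ?J" and r: "r \<in> carrier R"
  show *: "r \<otimes> a \<in> ?J"
  proof (clarsimp simp: a r, intro conjI ballI)
    show "r \<otimes> a \<in> carrier R" using a r by simp
    fix s assume s: "s \<in> B"
    have "s \<odot>\<^bsub>M\<^esub> (r \<otimes> a \<odot>\<^bsub>M\<^esub> x) = r \<odot>\<^bsub>M\<^esub> (s \<odot>\<^bsub>M\<^esub> (a \<odot>\<^bsub>M\<^esub> x))"
      using a r s x B by (simp add: smult_assoc1 smult_left_commute subset_iff)
    thus "s \<odot>\<^bsub>M\<^esub> (r \<otimes> a \<odot>\<^bsub>M\<^esub> x) = \<zero>\<^bsub>M\<^esub>" using a r s by simp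
  qed
  show "a \<otimes> r \<in> ?J" using * a r by (simp add: R.m_comm)
qed

lemma ideal_ann:
  assumes "x \<in> carrier M" shows "ideal (ann R M x) R"
proof -
  have "ann R M x = {r \<in> carrier R. \<forall>s\<in>{\<one>}. s \<odot>\<^bsub>M\<^esub> (r \<odot>\<^bsub>M\<^esub> x) = \<zero>\<^bsub>M\<^esub>}"
    using assms by (auto simp: ann_def)
  thus ?thesis using ideal_annihilating_multiple[OF assms, of "{\<one>}"] by simp
qed

lemma ann_subset_ann_smult:
  assumes "s \<in> carrier R" "x \<in> carrier M"
  shows "ann R M x \<subseteq> ann R M (s \<odot>\<^bsub>M\<^esub> x)"
  using assms by (auto simp: ann_def smult_left_commute[of _ s x])

lemma ann_smult_subset_prime:
  assumes P: "primeideal P R" and s: "s \<in> carrier R" "s \<notin> P"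
    and x: "x \<in> carrier M" "ann R M x \<subseteq> P"
  shows "ann R M (s \<odot>\<^bsub>M\<^esub> x) \<subseteq> P"
proof
  fix r assume r: "r \<in> ann R M (s \<odot>\<^bsub>M\<^esub> x)"
  hence "r \<otimes> s \<in> ann R M x" using s x by (simp add: ann_def smult_assoc1)
  thus "r \<in> P" using r primeideal.I_prime[OF P, of r s] s x by (auto simp: ann_def)
qed

lemma Ass_subset_weak_Ass: "Ass R M \<subseteq> weak_Ass R M"
  unfolding Ass_def weak_Ass_def Var_def by blast

lemma submodule_smult_image:
  assumes J: "ideal J R" and x: "x \<in> carrier M"
  shows "submodule ((\<lambda>r. r \<odot>\<^bsub>M\<^esub> x) ` J) R M"
proof -
  interpret J: ideal J R by (rule J)
  note J.Icarr[simp]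
  show ?thesis
  proof (rule submoduleI)
    show "(\<lambda>r. r \<odot>\<^bsub>M\<^esub> x) ` J \<subseteq> carrier M" using x by auto
    show "\<zero>\<^bsub>M\<^esub> \<in> (\<lambda>r. r \<odot>\<^bsub>M\<^esub> x) ` J"
      using x J.zero_closed by (force intro!: image_eqI[of _ _ \<zero>])
  next
    fix a assume "a \<in> (\<lambda>r. r \<odot>\<^bsub>M\<^esub> x) ` J"
    then obtain r where "r \<in> J" "a = r \<odot>\<^bsub>M\<^esub> x" by blast
    thus "\<ominus>\<^bsub>M\<^esub> a \<in> (\<lambda>r. r \<odot>\<^bsub>M\<^esub> x) ` J"
      using x by (auto simp: smult_l_minus intro!: image_eqI[of _ _ "\<ominus> r"])
  next
    fix a b assume "a \<in> (\<lambda>r. r \<odot>\<^bsub>M\<^esub> x) ` J" "b \<in> (\<lambda>r. r \<odot>\<^bsub>M\<^esub> x) ` J"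
    then obtain r s where "r \<in> J" "a = r \<odot>\<^bsub>M\<^esub> x" "s \<in> J" "b = s \<odot>\<^bsub>M\<^esub> x" by blast
    thus "a \<oplus>\<^bsub>M\<^esub> b \<in> (\<lambda>r. r \<odot>\<^bsub>M\<^esub> x) ` J"
      using x by (auto simp: smult_l_distr intro!: image_eqI[of _ _ "r \<oplus> s"])
  next
    fix a b assume a: "a \<in> carrier R" and "b \<in> (\<lambda>r. r \<odot>\<^bsub>M\<^esub> x) ` J"
    then obtain r where "r \<in> J" "b = r \<odot>\<^bsub>M\<^esub> x" by blast
    thus "a \<odot>\<^bsub>M\<^esub> b \<in> (\<lambda>r. r \<odot>\<^bsub>M\<^esub> x) ` J"
      using x a by (auto simp: smult_assoc1 J.I_l_closed intro!: image_eqI[of _ _ "a \<otimes> r"])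
  qed
qed

end

section \<open>Modules whose cyclic submodules are noetherian\<close>

text \<open>The submodules of \<open>Rx \<cong> R/(0 : x)\<close> correspond to the ideals containing \<open>(0 : x)\<close>, so
  the following chain condition says that \<open>Rx\<close> is noetherian for every \<open>x\<close>. It is the common
  consequence of the two alternative hypotheses of the theorem, and it passes to quotients.\<close>

locale cyclically_noetherian_module = module R M
  for R :: "('a, 'r) ring_scheme" (structure) and M :: "('a, 'b, 'm) module_scheme" +
  assumes chain_Union_mem:
    "\<lbrakk>x \<in> carrier M; C \<noteq> {}; subset.chain {J. ideal J R \<and> ann R M x \<subseteq> J} C\<rbrakk> \<Longrightarrow> \<Union>C \<in> C"

lemma (in module) noetherian_ring_imp_cyclically_noetherian:
  assumes "noetherian_ring R"
  shows "cyclically_noetherian_module R M"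
proof (unfold_locales)
  fix x C assume "C \<noteq> {}" "subset.chain {J. ideal J R \<and> ann R M x \<subseteq> J} C"
  thus "\<Union>C \<in> C"
    using noetherian_ring.ideal_chain_is_trivial[OF assms, of C]
    by (auto simp: pred_on.chain_def)
qed

text \<open>For a chain \<open>C\<close> of ideals containing \<open>(0 : x)\<close>, a finite generating set of \<open>(\<Union>C) x\<close> already
  lies in \<open>B x\<close> for one member \<open>B\<close> of \<open>C\<close>. Then \<open>(\<Union>C) x = B x\<close>, and \<open>(0 : x) \<subseteq> B\<close> allows
  cancelling \<open>x\<close>.\<close>

lemma noetherian_module_imp_cyclically_noetherian:
  assumes "noetherian_module R M"
  shows "cyclically_noetherian_module R M"
proof -
  interpret noetherian_module R M by (rule assms)
  show ?thesis
  proof (unfold_locales)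
    fix x C
    assume x: "x \<in> carrier M" and C: "C \<noteq> {}"
      and chain: "subset.chain {J. ideal J R \<and> ann R M x \<subseteq> J} C"
    let ?f = "\<lambda>r. r \<odot>\<^bsub>M\<^esub> x"
    have "subset.chain {J. ideal J R} C"
      using chain by (auto simp: pred_on.chain_def)
    hence "ideal (\<Union>C) R" using R.chain_Union_is_ideal[of C] C by simp
    from submodule_smult_image[OF this x]
    obtain S where S: "finite S" "?f ` \<Union>C = gen_submodule R M S"
      using finitely_gen by metis
    have "S \<subseteq> ?f ` \<Union>C" unfolding S(2) by (auto simp: gen_submodule_def)
    then obtain T where T: "T \<subseteq> \<Union>C" "finite T" "S = ?f ` T"
      using finite_subset_image[OF S(1)] by metis
    obtain B where B: "B \<in> C" "T \<subseteq> B"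
      using finite_subset_Union_chain[OF T(2,1) C chain] .
    hence idB: "ideal B R" and annB: "ann R M x \<subseteq> B"
      using chain by (auto simp: pred_on.chain_def)
    interpret B: ideal B R by (rule idB)
    have sub: "?f ` \<Union>C \<subseteq> ?f ` B"
      unfolding S(2) gen_submodule_def
      using submodule_smult_image[OF idB x] T(3) B(2) by blast
    have "\<Union>C \<subseteq> B"
    proof
      fix r assume r: "r \<in> \<Union>C"
      have rc: "r \<in> carrier R"
        using r chain by (auto simp: pred_on.chain_def dest: ideal.Icarr)
      obtain b where b: "b \<in> B" "r \<odot>\<^bsub>M\<^esub> x = b \<odot>\<^bsub>M\<^esub> x" using r sub by blast
      have bc: "b \<in> carrier R" using b B.Icarr by blast
      have "r \<ominus>\<^bsub>R\<^esub> b \<in> ann R M x"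
        using b(2) rc bc x by (simp add: ann_def R.minus_eq smult_l_distr smult_l_minus M.r_neg)
      hence "(r \<ominus>\<^bsub>R\<^esub> b) \<oplus>\<^bsub>R\<^esub> b \<in> B" using annB b(1) by blast
      thus "r \<in> B" using rc bc by (simp add: R.minus_eq R.a_assoc R.l_neg)
    qed
    hence "\<Union>C = B" using B(1) by blast
    thus "\<Union>C \<in> C" using B(1) by simp
  qed
qed

context cyclically_noetherian_module
begin

lemma exists_maximal_ideal:
  assumes x: "x \<in> carrier M" and "A \<noteq> {}"
    and A: "\<And>J. J \<in> A \<Longrightarrow> ideal J R \<and> ann R M x \<subseteq> J"
  obtains J where "J \<in> A" "\<And>K. K \<in> A \<Longrightarrow> J \<subseteq> K \<Longrightarrow> K = J"
proof -
  have "\<exists>J\<in>A. \<forall>K\<in>A. J \<subseteq> K \<longrightarrow> K = J"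
  proof (rule subset_Zorn_nonempty[OF \<open>A \<noteq> {}\<close>])
    fix C assume C: "C \<noteq> {}" "subset.chain A C"
    hence "subset.chain {J. ideal J R \<and> ann R M x \<subseteq> J} C"
      using A by (auto simp: pred_on.chain_def)
    from chain_Union_mem[OF x C(1) this] show "\<Union>C \<in> A"
      using C(2) by (auto simp: pred_on.chain_def)
  qed
  thus thesis using that by blast
qed

text \<open>A maximal element among the annihilators \<open>(0 : y) \<subseteq> P\<close> of multiples \<open>y\<close> of \<open>x\<close> is prime:
  if \<open>bc\<close> kills \<open>y\<close> and \<open>b\<close> does not, then \<open>(0 : cy)\<close> is strictly larger, hence contains some
  \<open>s \<notin> P\<close>; now \<open>(0 : sy)\<close> still lies in \<open>P\<close> and contains \<open>c\<close>, so \<open>c\<close> kills \<open>y\<close> by maximality.\<close>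

lemma exists_Ass_between:
  assumes x: "x \<in> carrier M" and P: "primeideal P R" "ann R M x \<subseteq> P"
  obtains Q where "Q \<in> Ass R M" "ann R M x \<subseteq> Q" "Q \<subseteq> P"
proof -
  interpret P: primeideal P R by (rule P(1))
  define A where "A = {ann R M (t \<odot>\<^bsub>M\<^esub> x) | t. t \<in> carrier R \<and> ann R M (t \<odot>\<^bsub>M\<^esub> x) \<subseteq> P}"
  have "ann R M (\<one> \<odot>\<^bsub>M\<^esub> x) \<in> A"
    unfolding A_def using x P(2) by (auto intro!: exI[of _ \<one>])
  hence "A \<noteq> {}" by blast
  moreover have "ideal J R \<and> ann R M x \<subseteq> J" if "J \<in> A" for J
    using that x ann_subset_ann_smult unfolding A_def by (auto intro!: ideal_ann)
  ultimately obtain J where J: "J \<in> A" and max: "\<And>K. K \<in> A \<Longrightarrow> J \<subseteq> K \<Longrightarrow> K = J"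
    using exists_maximal_ideal[OF x] by metis
  obtain t where t: "t \<in> carrier R" "J = ann R M (t \<odot>\<^bsub>M\<^esub> x)" "J \<subseteq> P"
    using J unfolding A_def by blast
  define y where "y = t \<odot>\<^bsub>M\<^esub> x"
  have y: "y \<in> carrier M" and Jy: "J = ann R M y" unfolding y_def using t x by auto
  have A_smult: "ann R M (s \<odot>\<^bsub>M\<^esub> y) \<in> A"
    if "s \<in> carrier R" "ann R M (s \<odot>\<^bsub>M\<^esub> y) \<subseteq> P" for s
    using that t x unfolding A_def y_def
    by (auto simp: smult_assoc1 intro!: exI[of _ "s \<otimes> t"])
  have "primeideal J R"
  proof (rule primeidealI)
    show "ideal J R" unfolding Jy by (rule ideal_ann[OF y])
    show "cring R" by (rule R.is_cring)
    show "carrier R \<noteq> J" using t(3) P.I_notcarr P.a_subset by blast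
  next
    fix b c assume b: "b \<in> carrier R" and c: "c \<in> carrier R" and bc: "b \<otimes> c \<in> J"
    show "b \<in> J \<or> c \<in> J"
    proof (rule disjCI, rule ccontr)
      assume cJ: "c \<notin> J" and bJ: "b \<notin> J"
      have "b \<in> ann R M (c \<odot>\<^bsub>M\<^esub> y)" using bc b c y unfolding Jy ann_def by (simp add: smult_assoc1)
      hence "\<not> ann R M (c \<odot>\<^bsub>M\<^esub> y) \<subseteq> P"
        using max[OF A_smult[OF c]] ann_subset_ann_smult[OF c y] bJ unfolding Jy by blast
      then obtain s where s: "s \<in> carrier R" "s \<odot>\<^bsub>M\<^esub> (c \<odot>\<^bsub>M\<^esub> y) = \<zero>\<^bsub>M\<^esub>" "s \<notin> P"
        unfolding ann_def by blast
      have "ann R M (s \<odot>\<^bsub>M\<^esub> y) \<subseteq> P"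
        using ann_smult_subset_prime[OF P(1) s(1,3) y] t(3) Jy by simp
      hence "ann R M (s \<odot>\<^bsub>M\<^esub> y) = J"
        using max[OF A_smult[OF s(1)]] ann_subset_ann_smult[OF s(1) y] unfolding Jy by blast
      moreover have "c \<in> ann R M (s \<odot>\<^bsub>M\<^esub> y)"
        using s c y by (simp add: ann_def smult_left_commute)
      ultimately show False using cJ by blast
    qed
  qed
  hence "J \<in> Ass R M" unfolding Ass_def using y Jy by blast
  moreover have "ann R M x \<subseteq> J" using ann_subset_ann_smult[OF t(1) x] t(2) by simp
  ultimately show thesis using that t(3) by blast
qed

lemma weak_Ass_eq_Ass: "weak_Ass R M = Ass R M"
proof
  show "weak_Ass R M \<subseteq> Ass R M"
  proof
    fix P assume "P \<in> weak_Ass R M"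
    then obtain x where x: "x \<in> carrier M" and P: "primeideal P R" "ann R M x \<subseteq> P"
      and min: "\<And>Q. Q \<in> Var R (ann R M x) \<Longrightarrow> Q \<subseteq> P \<Longrightarrow> Q = P"
      by (auto simp: weak_Ass_def Var_def)
    obtain Q where Q: "Q \<in> Ass R M" "ann R M x \<subseteq> Q" "Q \<subseteq> P"
      using exists_Ass_between[OF x P] .
    hence "Q \<in> Var R (ann R M x)" by (simp add: Var_def Ass_def)
    hence "Q = P" using Q(3) by (rule min)
    thus "P \<in> Ass R M" using Q(1) by simp
  qed
qed (rule Ass_subset_weak_Ass)

end

section \<open>Quotient modules\<close>

context module
begin

lemma abelian_subgroup_submodule:
  assumes "submodule N R M" shows "abelian_subgroup N M"
  using assms
  by (intro abelian_subgroupI3 additive_subgroupI M.abelian_group_axioms submodule.axioms(1))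

lemma coset_eq_iff_mem:
  assumes N: "submodule N R M" and x: "x \<in> carrier M"
  shows "N +>\<^bsub>M\<^esub> x = N \<longleftrightarrow> x \<in> N"
  using M.a_coset_join1[OF _ x] M.a_coset_join2[OF x] submodule.axioms(1)[OF N] by blast

lemma FactModule_carrier:
  "carrier (FactModule M N) = (\<lambda>x. N +>\<^bsub>M\<^esub> x) ` carrier M"
  by (auto simp: FactModule_def A_RCOSETS_def')

lemma FactModule_zero: "\<zero>\<^bsub>FactModule M N\<^esub> = N"
  by (simp add: FactModule_def)

lemma FactModule_add:
  assumes "submodule N R M" "x \<in> carrier M" "y \<in> carrier M"
  shows "(N +>\<^bsub>M\<^esub> x) \<oplus>\<^bsub>FactModule M N\<^esub> (N +>\<^bsub>M\<^esub> y) = N +>\<^bsub>M\<^esub> (x \<oplus>\<^bsub>M\<^esub> y)"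
  using abelian_subgroup.a_rcos_sum[OF abelian_subgroup_submodule] assms
  by (simp add: FactModule_def)

lemma FactModule_smult:
  assumes N: "submodule N R M" and r: "r \<in> carrier R" and x: "x \<in> carrier M"
  shows "r \<odot>\<^bsub>FactModule M N\<^esub> (N +>\<^bsub>M\<^esub> x) = N +>\<^bsub>M\<^esub> (r \<odot>\<^bsub>M\<^esub> x)"
proof -
  interpret N: abelian_subgroup N M by (rule abelian_subgroup_submodule[OF N])
  have "N +>\<^bsub>M\<^esub> (r \<odot>\<^bsub>M\<^esub> y) = N +>\<^bsub>M\<^esub> (r \<odot>\<^bsub>M\<^esub> x)" if y: "y \<in> N +>\<^bsub>M\<^esub> x" for y
  proof -
    obtain h where h: "h \<in> N" "y = h \<oplus>\<^bsub>M\<^esub> x" using y by (auto simp: a_r_coset_def')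
    have "r \<odot>\<^bsub>M\<^esub> h \<in> N" using submoduleE(4)[OF N r h(1)] .
    moreover have "r \<odot>\<^bsub>M\<^esub> y = r \<odot>\<^bsub>M\<^esub> h \<oplus>\<^bsub>M\<^esub> r \<odot>\<^bsub>M\<^esub> x"
      using h r x by (simp add: smult_r_distr)
    ultimately have "r \<odot>\<^bsub>M\<^esub> y \<in> N +>\<^bsub>M\<^esub> (r \<odot>\<^bsub>M\<^esub> x)" by (auto simp: a_r_coset_def')
    thus ?thesis
      using M.a_repr_independence[OF _ _ N.a_subgroup, of "r \<odot>\<^bsub>M\<^esub> y" "r \<odot>\<^bsub>M\<^esub> x"] r x by simp
  qed
  hence "(\<Union>y\<in>N +>\<^bsub>M\<^esub> x. N +>\<^bsub>M\<^esub> (r \<odot>\<^bsub>M\<^esub> y)) = (\<Union>y\<in>N +>\<^bsub>M\<^esub> x. N +>\<^bsub>M\<^esub> (r \<odot>\<^bsub>M\<^esub> x))"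
    by (rule SUP_cong[OF refl])
  also have "\<dots> = N +>\<^bsub>M\<^esub> (r \<odot>\<^bsub>M\<^esub> x)" using N.a_rcos_self[OF x] by blast
  finally show ?thesis by (simp add: FactModule_def)
qed

lemma module_FactModule:
  assumes N: "submodule N R M"
  shows "module R (FactModule M N)"
proof (rule moduleI)
  show "cring R" by (rule R.is_cring)
  have zero: "\<zero>\<^bsub>FactModule M N\<^esub> = N +>\<^bsub>M\<^esub> \<zero>\<^bsub>M\<^esub>"
    using coset_eq_iff_mem[OF N M.zero_closed] subgroup.one_closed[OF submodule.axioms(1)[OF N]]
    by (simp add: FactModule_zero)
  show "abelian_group (FactModule M N)"
  proof (rule abelian_groupI)
    fix U assume "U \<in> carrier (FactModule M N)"
    then obtain x where x: "x \<in> carrier M" "U = N +>\<^bsub>M\<^esub> x" by (auto simp: FactModule_carrier)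
    show "\<exists>V\<in>carrier (FactModule M N). V \<oplus>\<^bsub>FactModule M N\<^esub> U = \<zero>\<^bsub>FactModule M N\<^esub>"
      using x by (auto simp: FactModule_carrier FactModule_add[OF N] zero M.l_neg
          intro!: bexI[of _ "\<ominus>\<^bsub>M\<^esub> x"])
  qed (auto simp: FactModule_carrier FactModule_add[OF N] zero M.a_ac)
qed (auto simp: FactModule_carrier FactModule_smult[OF N] FactModule_add[OF N]
       smult_l_distr smult_r_distr smult_assoc1)

lemma ann_FactModule:
  assumes N: "submodule N R M" and x: "x \<in> carrier M"
  shows "ann R (FactModule M N) (N +>\<^bsub>M\<^esub> x) = {r \<in> carrier R. r \<odot>\<^bsub>M\<^esub> x \<in> N}"
  using x by (simp add: ann_def FactModule_zero FactModule_smult[OF N] coset_eq_iff_mem[OF N]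
      cong: conj_cong)

end

lemma (in cyclically_noetherian_module) cyclically_noetherian_FactModule:
  assumes N: "submodule N R M"
  shows "cyclically_noetherian_module R (FactModule M N)"
proof (rule cyclically_noetherian_module.intro[OF module_FactModule[OF N]],
    rule cyclically_noetherian_module_axioms.intro)
  fix U C
  assume U: "U \<in> carrier (FactModule M N)" and C: "C \<noteq> {}"
    and chain: "subset.chain {J. ideal J R \<and> ann R (FactModule M N) U \<subseteq> J} C"
  obtain x where x: "x \<in> carrier M" "U = N +>\<^bsub>M\<^esub> x"
    using U unfolding FactModule_carrier by blast
  have "\<zero>\<^bsub>M\<^esub> \<in> N" using subgroup.one_closed[OF submodule.axioms(1)[OF N]] by simp
  hence "ann R M x \<subseteq> ann R (FactModule M N) U"
    unfolding x(2) ann_FactModule[OF N x(1)] by (auto simp: mem_ann_iff)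
  hence "subset.chain {J. ideal J R \<and> ann R M x \<subseteq> J} C"
    using chain by (auto simp: pred_on.chain_def)
  thus "\<Union>C \<in> C" by (rule chain_Union_mem[OF x(1) C])
qed

section \<open>Powers of an ideal and torsion\<close>

context cring
begin

lemma ideal_pow_0: "I [^]\<^bsub>ideals_set R\<^esub> (0::nat) = carrier R"
  by (simp add: ideals_set_def nat_pow_def)

lemma ideal_pow_Suc: "I [^]\<^bsub>ideals_set R\<^esub> Suc n = (I [^]\<^bsub>ideals_set R\<^esub> n) \<cdot> I"
  by (simp add: ideals_set_def nat_pow_def)

lemma ideal_ideal_pow:
  assumes "ideal I R" shows "ideal (I [^]\<^bsub>ideals_set R\<^esub> (n::nat)) R"
  by (induction n) (simp_all only: ideal_pow_0 ideal_pow_Suc oneideal ideal_prod_is_ideal assms)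

lemma ideal_pow_antimono:
  assumes I: "ideal I R" and "m \<le> n"
  shows "I [^]\<^bsub>ideals_set R\<^esub> (n::nat) \<subseteq> I [^]\<^bsub>ideals_set R\<^esub> m"
  using \<open>m \<le> n\<close>
proof (induction rule: dec_induct)
  case (step n)
  thus ?case
    using ideal_prod_inter[OF ideal_ideal_pow[OF I, of n] I] unfolding ideal_pow_Suc by blast
qed simp

lemma ideal_pow_not_subset_prime:
  assumes P: "primeideal P R" and I: "ideal I R" "\<not> I \<subseteq> P"
  shows "\<not> I [^]\<^bsub>ideals_set R\<^esub> (n::nat) \<subseteq> P"
proof (induction n)
  case 0
  interpret P: primeideal P R by (rule P)
  show ?case unfolding ideal_pow_0 using P.I_notcarr P.a_subset by blast
next
  case (Suc n)
  then obtain s where s: "s \<in> I [^]\<^bsub>ideals_set R\<^esub> n" "s \<notin> P" by blast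
  obtain t where t: "t \<in> I" "t \<notin> P" using I by blast
  have "s \<in> carrier R" "t \<in> carrier R"
    using s t ideal.Icarr ideal_ideal_pow[OF I(1)] I(1) by metis+
  hence "s \<otimes> t \<notin> P" using primeideal.I_prime[OF P] s t by blast
  thus ?case unfolding ideal_pow_Suc using ideal_prod.prod[OF s(1) t(1)] by blast
qed

end

context module
begin

lemma mem_torsion_part_iff:
  "x \<in> torsion_part R I M \<longleftrightarrow>
    x \<in> carrier M \<and> (\<exists>n::nat. \<forall>s \<in> I [^]\<^bsub>ideals_set R\<^esub> n. s \<odot>\<^bsub>M\<^esub> x = \<zero>\<^bsub>M\<^esub>)"
  by (simp add: torsion_part_def)

lemma submodule_torsion_part:
  assumes I: "ideal I R"
  shows "submodule (torsion_part R I M) R M"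
proof (rule submoduleI)
  note [simp] = ideal.Icarr[OF R.ideal_ideal_pow[OF I]]
  show "torsion_part R I M \<subseteq> carrier M" by (auto simp: torsion_part_def)
  show "\<zero>\<^bsub>M\<^esub> \<in> torsion_part R I M" by (auto simp: torsion_part_def)
  show "\<ominus>\<^bsub>M\<^esub> a \<in> torsion_part R I M" if "a \<in> torsion_part R I M" for a
    using that by (fastforce simp: torsion_part_def smult_r_minus)
  show "r \<odot>\<^bsub>M\<^esub> a \<in> torsion_part R I M"
    if r: "r \<in> carrier R" and a: "a \<in> torsion_part R I M" for r a
  proof -
    obtain n :: nat where n: "a \<in> carrier M" "\<forall>s \<in> I [^]\<^bsub>ideals_set R\<^esub> n. s \<odot>\<^bsub>M\<^esub> a = \<zero>\<^bsub>M\<^esub>"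
      using a by (auto simp: mem_torsion_part_iff)
    hence "s \<odot>\<^bsub>M\<^esub> (r \<odot>\<^bsub>M\<^esub> a) = \<zero>\<^bsub>M\<^esub>" if "s \<in> I [^]\<^bsub>ideals_set R\<^esub> n" for s
      using that r smult_left_commute[of s r a] by simp
    thus ?thesis using n r by (auto simp: mem_torsion_part_iff)
  qed
  show "a \<oplus>\<^bsub>M\<^esub> b \<in> torsion_part R I M"
    if a: "a \<in> torsion_part R I M" and b: "b \<in> torsion_part R I M" for a b
  proof -
    obtain m n :: nat
      where m: "a \<in> carrier M" "\<forall>s \<in> I [^]\<^bsub>ideals_set R\<^esub> m. s \<odot>\<^bsub>M\<^esub> a = \<zero>\<^bsub>M\<^esub>"
        and n: "b \<in> carrier M" "\<forall>s \<in> I [^]\<^bsub>ideals_set R\<^esub> n. s \<odot>\<^bsub>M\<^esub> b = \<zero>\<^bsub>M\<^esub>"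
      using a b by (auto simp: mem_torsion_part_iff)
    have "s \<odot>\<^bsub>M\<^esub> (a \<oplus>\<^bsub>M\<^esub> b) = \<zero>\<^bsub>M\<^esub>" if s: "s \<in> I [^]\<^bsub>ideals_set R\<^esub> (max m n)" for s
    proof -
      have "s \<in> I [^]\<^bsub>ideals_set R\<^esub> m" "s \<in> I [^]\<^bsub>ideals_set R\<^esub> n"
        using s R.ideal_pow_antimono[OF I, of m "max m n"] R.ideal_pow_antimono[OF I, of n "max m n"]
        by auto
      thus ?thesis using m n by (simp add: smult_r_distr)
    qed
    thus ?thesis using m(1) n(1) by (auto simp: mem_torsion_part_iff)
  qed
qed

text \<open>If \<open>P = (0 : x)\<close> does not contain \<open>I\<close>, then \<open>I\<^sup>n r x = 0\<close> means \<open>I\<^sup>n r \<subseteq> P\<close>, which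
  forces \<open>r \<in> P\<close>: the annihilator of \<open>x\<close> does not grow when passing to the quotient.\<close>

lemma Ass_minus_Var_subset:
  assumes I: "ideal I R"
  shows "Ass R M - Var R I \<subseteq> Ass R (FactModule M (torsion_part R I M))"
proof
  fix P assume "P \<in> Ass R M - Var R I"
  then obtain x where P: "primeideal P R" "\<not> I \<subseteq> P" and x: "x \<in> carrier M" "P = ann R M x"
    unfolding Ass_def Var_def by blast
  let ?N = "torsion_part R I M"
  note N = submodule_torsion_part[OF I]
  have "{r \<in> carrier R. r \<odot>\<^bsub>M\<^esub> x \<in> ?N} = P"
  proof
    show "P \<subseteq> {r \<in> carrier R. r \<odot>\<^bsub>M\<^esub> x \<in> ?N}"
      using subgroup.one_closed[OF submodule.axioms(1)[OF N]] x by (auto simp: ann_def)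
    show "{r \<in> carrier R. r \<odot>\<^bsub>M\<^esub> x \<in> ?N} \<subseteq> P"
    proof clarify
      fix r assume r: "r \<in> carrier R" "r \<odot>\<^bsub>M\<^esub> x \<in> ?N"
      then obtain n :: nat where n: "\<forall>s \<in> I [^]\<^bsub>ideals_set R\<^esub> n. s \<odot>\<^bsub>M\<^esub> (r \<odot>\<^bsub>M\<^esub> x) = \<zero>\<^bsub>M\<^esub>"
        by (auto simp: mem_torsion_part_iff)
      obtain s where s: "s \<in> I [^]\<^bsub>ideals_set R\<^esub> n" "s \<notin> P"
        using R.ideal_pow_not_subset_prime[OF P(1) I P(2)] by blast
      have sc: "s \<in> carrier R" using ideal.Icarr[OF R.ideal_ideal_pow[OF I] s(1)] .
      have "s \<otimes> r \<in> P" using n s(1) sc r x by (simp add: ann_def smult_assoc1)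
      thus "r \<in> P" using primeideal.I_prime[OF P(1) sc r(1)] s(2) by blast
    qed
  qed
  hence "P = ann R (FactModule M ?N) (?N +>\<^bsub>M\<^esub> x)" using ann_FactModule[OF N x(1)] by simp
  thus "P \<in> Ass R (FactModule M ?N)"
    unfolding Ass_def using P(1) x(1) by (auto simp: FactModule_carrier)
qed

end

section \<open>Fairness\<close>

context cyclically_noetherian_module
begin

text \<open>The ideals \<open>(0 : I\<^sup>n x)\<close> form an ascending chain above \<open>(0 : x)\<close> with union
  the annihilator of \<open>x + \<Gamma>\<close>, so the chain condition gives a single exponent for all of them.\<close>

lemma torsion_uniform_exponent:
  assumes I: "ideal I R" and x: "x \<in> carrier M"
  obtains n :: nat where "\<And>r s. \<lbrakk>r \<in> carrier R; r \<odot>\<^bsub>M\<^esub> x \<in> torsion_part R I M;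
      s \<in> I [^]\<^bsub>ideals_set R\<^esub> n\<rbrakk> \<Longrightarrow> s \<odot>\<^bsub>M\<^esub> (r \<odot>\<^bsub>M\<^esub> x) = \<zero>\<^bsub>M\<^esub>"
proof -
  note Icarr = ideal.Icarr[OF R.ideal_ideal_pow[OF I]]
  define J :: "nat \<Rightarrow> 'a set" where
    "J n = {r \<in> carrier R. \<forall>s \<in> I [^]\<^bsub>ideals_set R\<^esub> n. s \<odot>\<^bsub>M\<^esub> (r \<odot>\<^bsub>M\<^esub> x) = \<zero>\<^bsub>M\<^esub>}" for n
  have mono: "J m \<subseteq> J n" if "m \<le> n" for m n
    unfolding J_def using R.ideal_pow_antimono[OF I that] by blast
  have "ideal (J n) R" for n
    unfolding J_def by (rule ideal_annihilating_multiple[OF x]) (auto intro: Icarr)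
  moreover have "ann R M x \<subseteq> J n" for n
    unfolding J_def ann_def by (auto dest: Icarr)
  moreover have "J m \<subseteq> J n \<or> J n \<subseteq> J m" for m n
    using mono nat_le_linear by blast
  ultimately have "subset.chain {J. ideal J R \<and> ann R M x \<subseteq> J} (range J)"
    unfolding subset_chain_def by auto
  from chain_Union_mem[OF x _ this] obtain n where n: "\<Union>(range J) = J n" by auto
  show thesis
  proof (rule that[of n])
    fix r s assume r: "r \<in> carrier R" "r \<odot>\<^bsub>M\<^esub> x \<in> torsion_part R I M"
      and s: "s \<in> I [^]\<^bsub>ideals_set R\<^esub> n"
    have "r \<in> \<Union>(range J)" using r by (auto simp: J_def mem_torsion_part_iff)
    thus "s \<odot>\<^bsub>M\<^esub> (r \<odot>\<^bsub>M\<^esub> x) = \<zero>\<^bsub>M\<^esub>" unfolding n using s by (simp add: J_def)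
  qed
qed

text \<open>Let \<open>P\<close> be the annihilator of \<open>x + \<Gamma>\<close> and \<open>n\<close> an exponent with \<open>I\<^sup>n P x = 0\<close>. If
  \<open>I \<subseteq> P\<close>, then \<open>I\<^sup>n\<^sup>+\<^sup>1\<close> kills \<open>x\<close>, so \<open>x \<in> \<Gamma>\<close> and \<open>P\<close> would be the unit ideal. Otherwise any
  \<open>s \<in> I\<^sup>n - P\<close> gives \<open>P = (0 : sx)\<close>.\<close>

lemma Ass_FactModule_torsion_subset:
  assumes I: "ideal I R"
  shows "Ass R (FactModule M (torsion_part R I M)) \<subseteq> Ass R M - Var R I"
proof
  let ?N = "torsion_part R I M"
  note N = submodule_torsion_part[OF I]
  note Icarr = ideal.Icarr[OF R.ideal_ideal_pow[OF I]]
  fix P assume "P \<in> Ass R (FactModule M ?N)"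
  then obtain x where P: "primeideal P R" and x: "x \<in> carrier M"
    and "P = ann R (FactModule M ?N) (?N +>\<^bsub>M\<^esub> x)"
    unfolding Ass_def by (auto simp: FactModule_carrier)
  hence P_eq: "P = {r \<in> carrier R. r \<odot>\<^bsub>M\<^esub> x \<in> ?N}" using ann_FactModule[OF N x] by simp
  interpret P: primeideal P R by (rule P)
  obtain n :: nat where n: "\<And>r s. \<lbrakk>r \<in> P; s \<in> I [^]\<^bsub>ideals_set R\<^esub> n\<rbrakk> \<Longrightarrow> s \<odot>\<^bsub>M\<^esub> (r \<odot>\<^bsub>M\<^esub> x) = \<zero>\<^bsub>M\<^esub>"
    using torsion_uniform_exponent[OF I x] unfolding P_eq by (metis (no_types, lifting) mem_Collect_eq)
  have notsub: "\<not> I \<subseteq> P"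
  proof
    assume IP: "I \<subseteq> P"
    have "s \<odot>\<^bsub>M\<^esub> x = \<zero>\<^bsub>M\<^esub>" if "s \<in> I [^]\<^bsub>ideals_set R\<^esub> Suc n" for s
    proof -
      have "s \<in> carrier R \<and> s \<odot>\<^bsub>M\<^esub> x = \<zero>\<^bsub>M\<^esub>"
        using that unfolding R.ideal_pow_Suc
      proof (induction rule: ideal_prod.induct)
        case (prod i j)
        hence "i \<in> carrier R" "j \<in> carrier R" using Icarr IP P.Icarr by blast+
        thus ?case using n[of j i] prod IP x by (auto simp: smult_assoc1)
      qed (use x in \<open>auto simp: smult_l_distr\<close>)
      thus ?thesis by blast
    qed
    hence "x \<in> ?N" unfolding mem_torsion_part_iff using x by blast
    hence "\<one> \<in> P" unfolding P_eq using x by (auto simp only: smult_one R.one_closed mem_Collect_eq)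
    thus False using P.one_imp_carrier P.I_notcarr by blast
  qed
  obtain s where s: "s \<in> I [^]\<^bsub>ideals_set R\<^esub> n" "s \<notin> P"
    using R.ideal_pow_not_subset_prime[OF P I notsub] by blast
  have sc: "s \<in> carrier R" using Icarr[OF s(1)] .
  have "\<zero>\<^bsub>M\<^esub> \<in> ?N" using subgroup.one_closed[OF submodule.axioms(1)[OF N]] by simp
  hence "ann R M x \<subseteq> P" unfolding P_eq by (auto simp: ann_def)
  hence "ann R M (s \<odot>\<^bsub>M\<^esub> x) \<subseteq> P" by (rule ann_smult_subset_prime[OF P sc s(2) x])
  moreover have "P \<subseteq> ann R M (s \<odot>\<^bsub>M\<^esub> x)"
  proof
    fix r assume r: "r \<in> P"
    hence "r \<in> carrier R" by (rule P.Icarr)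
    thus "r \<in> ann R M (s \<odot>\<^bsub>M\<^esub> x)"
      using n[OF r s(1)] sc x smult_left_commute[of r s x] by (simp add: ann_def)
  qed
  ultimately have "P = ann R M (s \<odot>\<^bsub>M\<^esub> x)" by blast
  hence "P \<in> Ass R M" unfolding Ass_def using P sc x by blast
  thus "P \<in> Ass R M - Var R I" using notsub unfolding Var_def by blast
qed

lemma fair_ideal: "ideal I R \<Longrightarrow> fair R I M"
  unfolding fair_def
  using Ass_FactModule_torsion_subset Ass_minus_Var_subset by blast

lemma weakly_fair_ideal:
  assumes I: "ideal I R" shows "weakly_fair R I M"
proof -
  interpret Q: cyclically_noetherian_module R "FactModule M (torsion_part R I M)"
    by (rule cyclically_noetherian_FactModule[OF submodule_torsion_part[OF I]])
  show ?thesis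
    using fair_ideal[OF I] by (simp add: fair_def weakly_fair_def weak_Ass_eq_Ass Q.weak_Ass_eq_Ass)
qed

end

theorem mainTheorem3:
  fixes R :: "('a, 'r) ring_scheme"
    and M :: "('a, 'b, 'm) module_scheme"
    and \<aa> :: "'a set"
  assumes "module R M"
    and "ideal \<aa> R"
    and "noetherian_ring R \<or> noetherian_module R M"
  shows "fair R \<aa> M \<and> weakly_fair R \<aa> M"
proof -
  interpret module R M by (rule assms(1))
  interpret cyclically_noetherian_module R M
    using assms(3) noetherian_ring_imp_cyclically_noetherian
      noetherian_module_imp_cyclically_noetherian by blast
  show ?thesis using fair_ideal weakly_fair_ideal assms(2) by blast
qed

end
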